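(* For every $n,m\in\mathbb{N}$ with $m\ge2$, $$\sum_{k\in\mathrm{Reg}_n}B_m(k/n)=B_m\,\varrho_{1-m}(n),$$ where $\varrho_{1-m}(n)=n^{1-m}\prod_{p^{\nu}\,\|\,n}\left(p^{(m-1)\nu}-p^{m-1}+1\right)$.
   Context: $\mathbb{N}=\{1,2,\ldots\}$. An integer $k$ is called regular (mod $n$) if there exists $x\in\mathbb{Z}$ with $k^2x\equiv k\pmod n$, and $\mathrm{Reg}_n=\{k\in\mathbb{N}:1\le k\le n,\ k\text{ is regular (mod }n)\}$. $d\,\|\,n$ means that $d$ is a unitary divisor of $n$, i.e. $d\ge1$, $d\mid n$ and $\gcd(d,n/d)=1$; the product over $p^{\nu}\,\|\,n$ runs over the prime powers $p^\nu$ ($\nu\ge1$) in the prime factorization of $n$ (empty product $=1$). For a real number $s$, $\phi_s(n)=\sum_{d\mid n}d^s\mu(n/d)$ ($\mu$ is the Möbius function) and $\varrho_s(n)=\sum_{d\,\|\,n}\phi_s(d)$. $B_m(x)$ are the Bernoulli polynomials defined by $\frac{te^{xt}}{e^t-1}=\sum_{m=0}^\infty B_m(x)\frac{t^m}{m!}$, and $B_m=B_m(0)$ are the Bernoulli numbers. *)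

theory Defs
  imports
    Complex_Main
    "HOL-Number_Theory.Cong"
    "HOL-Computational_Algebra.Squarefree"
    "HOL-Computational_Algebra.Formal_Power_Series"
begin

definition regular_mod :: "nat \<Rightarrow> int \<Rightarrow> bool" where
  "regular_mod n k \<longleftrightarrow> (\<exists>x::int. [k\<^sup>2 * x = k] (mod int n))"

definition Reg :: "nat \<Rightarrow> nat set" where
  "Reg n = {k. 1 \<le> k \<and> k \<le> n \<and> regular_mod n (int k)}"

definition unitary_divisor :: "nat \<Rightarrow> nat \<Rightarrow> bool" where
  "unitary_divisor d n \<longleftrightarrow> d \<ge> 1 \<and> d dvd n \<and> coprime d (n div d)"

definition moebius_mu :: "nat \<Rightarrow> int" where
  "moebius_mu n = (if squarefree n then (- 1) ^ card (prime_factors n) else 0)"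

definition phi :: "real \<Rightarrow> nat \<Rightarrow> real" where
  "phi s n = (\<Sum>d | d dvd n. real d powr s * of_int (moebius_mu (n div d)))"

definition varrho :: "real \<Rightarrow> nat \<Rightarrow> real" where
  "varrho s n = (\<Sum>d | unitary_divisor d n. phi s d)"

text \<open>
  The generating function \<open>t e\<^sup>x\<^sup>t / (e\<^sup>t - 1)\<close> as a formal power series in \<open>t\<close>. The divisor
  has zero constant term, but the quotient is exact, as the lemma below records.
\<close>

definition bernoulli_fps :: "real \<Rightarrow> real fps" where
  "bernoulli_fps x = fps_X * fps_exp x / (fps_exp 1 - 1)"

lemma bernoulli_fps_mult: "bernoulli_fps x * (fps_exp 1 - 1) = fps_X * fps_exp x"
proof -
  have *: "subdegree (fps_exp (1::real) - 1) = 1"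
    by (rule subdegreeI) auto
  have "subdegree (fps_X * fps_exp x) = 1"
    by (rule subdegreeI) auto
  moreover have "fps_X * fps_exp x \<noteq> 0"
    by auto
  moreover have "fps_exp (1::real) - 1 \<noteq> 0"
    using * by auto
  ultimately have "fps_exp 1 - 1 dvd fps_X * fps_exp x"
    using * by (simp add: fps_dvd_iff)
  then show ?thesis
    by (simp add: bernoulli_fps_def)
qed

definition bernpoly :: "nat \<Rightarrow> real \<Rightarrow> real" where
  "bernpoly m x = fact m * fps_nth (bernoulli_fps x) m"

definition bernoulli :: "nat \<Rightarrow> real" where
  "bernoulli m = bernpoly m 0"

end

theory Submission
  imports Defs
begin

text \<open>
  An integer \<open>k\<close> is regular mod \<open>n\<close> iff \<open>gcd k n\<close> is a unitary divisor of \<open>n\<close>, so reducing the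
  fractions \<open>k / n\<close> groups the sum over \<open>Reg n\<close> into sums over the primitive fractions \<open>j / d\<close>, one
  for each unitary divisor \<open>d\<close> of \<open>n\<close>. By Moebius inversion and the multiplication formula
  \<open>\<Sum>j=1..d. B\<^sub>m (j / d) = d powr (1 - m) * B\<^sub>m\<close>, each of these equals \<open>B\<^sub>m * phi (1 - m) d\<close>. The product
  formula holds since \<open>phi s\<close> and hence \<open>varrho s\<close> are multiplicative.
\<close>

section \<open>Multiplicative functions\<close>

text \<open>A divisor of \<open>a * b\<close> splits uniquely as \<open>d * c\<close> with
  \<open>d dvd a\<close> and \<open>c dvd b\<close>; the two parts are recovered as its gcds with
  \<open>a\<close> and \<open>b\<close>.\<close>

lemma sum_divisors_mult_coprime:
  fixes a b :: nat and f :: "nat \<Rightarrow> 'a::comm_monoid_add"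
  assumes ab: "coprime a b"
  shows "(\<Sum>d | d dvd a * b. f d) = (\<Sum>d | d dvd a. \<Sum>c | c dvd b. f (d * c))"
proof (cases "a = 0 \<or> b = 0")
  case True
  \<comment> \<open>If one factor is 0, coprimality forces the other to be 1, and both sides are the
    same sum over all naturals.\<close>
  then show ?thesis using ab by auto
next
  case False
  have gcds: "gcd (d * c) a = d" "gcd (d * c) b = c" if dc: "d dvd a" "c dvd b" for d c
  proof -
    have "coprime a c" "coprime b d"
      using coprime_divisors[OF dvd_refl dc(2) ab] coprime_divisors[OF dc(1) dvd_refl ab]
      by (simp_all add: coprime_commute)
    then show "gcd (d * c) a = d" "gcd (d * c) b = c"
      using dc by (simp_all add: gcd_mult_left_right_cancel gcd_mult_left_left_cancel gcd_nat.absorb1)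
  qed
  have "(\<Sum>d | d dvd a. \<Sum>c | c dvd b. f (d * c))
      = (\<Sum>(d, c) \<in> {d. d dvd a} \<times> {c. c dvd b}. f (d * c))"
    using False by (simp add: sum.cartesian_product)
  also have "\<dots> = (\<Sum>d | d dvd a * b. f d)"
  proof (rule sum.reindex_bij_witness[where i = "\<lambda>d. (gcd d a, gcd d b)" and j = "\<lambda>(d, c). d * c"])
    fix p assume p: "p \<in> {d. d dvd a} \<times> {c. c dvd b}"
    obtain d c where [simp]: "p = (d, c)" and dc: "d dvd a" "c dvd b"
      using p by auto
    show "(gcd (case p of (d, c) \<Rightarrow> d * c) a, gcd (case p of (d, c) \<Rightarrow> d * c) b) = p"
      using gcds[OF dc] by simp
    show "(case p of (d, c) \<Rightarrow> d * c) \<in> {d. d dvd a * b}"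
      using dc by (simp add: mult_dvd_mono)
    show "f (case p of (d, c) \<Rightarrow> d * c) = (case p of (d, c) \<Rightarrow> f (d * c))"
      by simp
  next
    fix d assume d: "d \<in> {d. d dvd a * b}"
    then obtain x y where "d = x * y" "x dvd a" "y dvd b"
      using division_decomp[of d a b] by auto
    then show "(case (gcd d a, gcd d b) of (d, c) \<Rightarrow> d * c) = d"
      using gcds by simp
    show "(gcd d a, gcd d b) \<in> {d. d dvd a} \<times> {c. c dvd b}"
      by simp
  qed
  finally show ?thesis ..
qed

text \<open>Reduces evaluations to prime powers; applied below to \<open>varrho\<close>, to
  \<open>phi 0\<close> and to powers of \<open>n\<close>.\<close>

lemma multiplicative_prod_prime_powers:
  fixes f :: "nat \<Rightarrow> 'a::comm_monoid_mult"
  assumes one: "f 1 = 1"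
    and mult: "\<And>a b. a > 0 \<Longrightarrow> b > 0 \<Longrightarrow> coprime a b \<Longrightarrow> f (a * b) = f a * f b"
    and "n > 0"
  shows "f n = (\<Prod>p\<in>prime_factors n. f (p ^ multiplicity p n))"
proof -
  \<comment> \<open>The exponents \<open>e\<close> are decoupled from \<open>n\<close>, so that the
    induction can run over the set of primes alone.\<close>
  have "f (\<Prod>p\<in>A. p ^ e p) = (\<Prod>p\<in>A. f (p ^ e p))"
    if "finite A" "\<And>p. p \<in> A \<Longrightarrow> prime p" for A :: "nat set" and e
    using that
  proof (induction A rule: finite_induct)
    case empty
    then show ?case using one by simp
  next
    case (insert q A)
    have "coprime (q ^ e q) (\<Prod>p\<in>A. p ^ e p)"
      using insert by (intro prod_coprime_right) (auto intro!: primes_coprime)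
    moreover have "(\<Prod>p\<in>A. p ^ e p) > 0"
      using insert by (intro prod_pos) (auto simp: prime_gt_0_nat)
    ultimately show ?case
      using insert mult by (simp add: prime_gt_0_nat)
  qed
  from this[of "prime_factors n" "\<lambda>p. multiplicity p n"] show ?thesis
    using prime_factorization_nat[OF \<open>n > 0\<close>] by auto
qed

section \<open>The Moebius function and \<open>phi\<close>\<close>

lemma moebius_mu_mult_coprime:
  assumes "coprime a b" "a > 0" "b > 0"
  shows "moebius_mu (a * b) = moebius_mu a * moebius_mu b"
proof -
  have "squarefree (a * b) \<longleftrightarrow> squarefree a \<and> squarefree b"
    using assms by (auto dest: squarefree_multD intro: squarefree_mult_coprime)
  moreover have "prime_factors a \<inter> prime_factors b = {}"
    using assms by (auto simp: prime_factors_dvd dest: coprime_common_divisor_nat)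
  then have "card (prime_factors (a * b)) = card (prime_factors a) + card (prime_factors b)"
    using assms by (simp add: prime_factors_product card_Un_disjoint)
  ultimately show ?thesis
    by (simp add: moebius_mu_def power_add)
qed

lemma moebius_mu_prime_power:
  assumes "prime p"
  shows "moebius_mu (p ^ i) = (if i = 0 then 1 else if i = 1 then -1 else 0)"
proof -
  have "\<not> is_unit p" using assms by auto
  then have "squarefree (p ^ i) \<longleftrightarrow> i \<le> 1"
    using assms by (auto simp: squarefree_power_iff squarefree_prime)
  then show ?thesis
    using assms by (auto simp: moebius_mu_def prime_factorization_prime_power prime_prime_factors)
qed

lemma phi_1: "phi s 1 = 1"
  by (simp add: phi_def moebius_mu_def)

lemma phi_mult_coprime:
  assumes "coprime a b" "a > 0" "b > 0"
  shows "phi s (a * b) = phi s a * phi s b"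
proof -
  have "phi s (a * b)
      = (\<Sum>d | d dvd a. \<Sum>c | c dvd b. real (d * c) powr s * of_int (moebius_mu (a * b div (d * c))))"
    unfolding phi_def by (rule sum_divisors_mult_coprime[OF assms(1)])
  also have "\<dots> = (\<Sum>d | d dvd a. \<Sum>c | c dvd b.
      (real d powr s * of_int (moebius_mu (a div d))) * (real c powr s * of_int (moebius_mu (b div c))))"
  proof (intro sum.cong refl)
    fix d c assume "d \<in> {d. d dvd a}" "c \<in> {c. c dvd b}"
    then have dc: "d dvd a" "c dvd b" by auto
    have "a * b div (d * c) = (a div d) * (b div c)"
      using dc by (simp add: div_mult_div_if_dvd)
    moreover have "coprime (a div d) (b div c)"
      using dc by (intro coprime_divisors[OF _ _ assms(1)]) (auto simp: div_dvd_iff_mult)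
    moreover have "a div d > 0" "b div c > 0"
      using dc assms by (auto simp: dvd_div_eq_0_iff intro!: Nat.gr0I)
    ultimately show "real (d * c) powr s * of_int (moebius_mu (a * b div (d * c)))
      = (real d powr s * of_int (moebius_mu (a div d))) * (real c powr s * of_int (moebius_mu (b div c)))"
      by (simp add: moebius_mu_mult_coprime powr_mult)
  qed
  also have "\<dots> = phi s a * phi s b"
    by (simp add: phi_def sum_product)
  finally show ?thesis .
qed

lemma sum_divisors_prime_power:
  fixes p :: nat and f :: "nat \<Rightarrow> 'a::comm_monoid_add"
  assumes "prime p"
  shows "(\<Sum>d | d dvd p ^ a. f d) = (\<Sum>i\<le>a. f (p ^ i))"
proof -
  have "{d. d dvd p ^ a} = (\<lambda>i. p ^ i) ` {..a}"
    using assms by (auto simp: divides_primepow_nat)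
  moreover have "inj_on (\<lambda>i. p ^ i) {..a}"
    using prime_gt_1_nat[OF assms] by (auto intro!: inj_onI)
  ultimately show ?thesis
    by (simp add: sum.reindex)
qed

text \<open>The Moebius function vanishes at \<open>p ^ (a - i)\<close> unless \<open>a - i\<close>
  is 0 or 1, so only the two largest divisors contribute.\<close>

lemma phi_prime_power:
  assumes p: "prime p" and a: "a > 0"
  shows "phi s (p ^ a) = real (p ^ a) powr s - real (p ^ (a - 1)) powr s"
proof -
  obtain b where b: "a = Suc b" using a by (cases a) auto
  have "phi s (p ^ a) = (\<Sum>i\<le>a. real (p ^ i) powr s * of_int (moebius_mu (p ^ (a - i))))"
    unfolding phi_def sum_divisors_prime_power[OF p]
    using p by (intro sum.cong refl) (simp add: power_diff prime_gt_0_nat)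
  also have "\<dots> = real (p ^ a) powr s - real (p ^ b) powr s
      + (\<Sum>i<b. real (p ^ i) powr s * of_int (moebius_mu (p ^ (a - i))))"
    using p by (simp add: b moebius_mu_prime_power flip: lessThan_Suc_atMost)
  also have "(\<Sum>i<b. real (p ^ i) powr s * of_int (moebius_mu (p ^ (a - i)))) = 0"
    using p by (intro sum.neutral) (auto simp: b moebius_mu_prime_power)
  finally show ?thesis by (simp add: b)
qed

section \<open>Unitary divisors and \<open>varrho\<close>\<close>

lemma unitary_divisor_mult_coprime:
  assumes ab: "coprime a b" and d: "d dvd a" and c: "c dvd b"
  shows "unitary_divisor (d * c) (a * b) \<longleftrightarrow> unitary_divisor d a \<and> unitary_divisor c b"
proof -
  have "a * b div (d * c) = (a div d) * (b div c)"
    using d c by (simp add: div_mult_div_if_dvd)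
  \<comment> \<open>The mixed pairs are coprime automatically, which leaves exactly one condition
    inside \<open>a\<close> and one inside \<open>b\<close>.\<close>
  moreover have "coprime d (b div c)" "coprime (a div d) c"
    using d c by (auto intro!: coprime_divisors[OF _ _ ab] simp: div_dvd_iff_mult)
  ultimately show ?thesis
    using d c by (auto simp: unitary_divisor_def mult_dvd_mono coprime_commute)
qed

lemma varrho_mult_coprime:
  assumes "coprime a b" "a > 0" "b > 0"
  shows "varrho s (a * b) = varrho s a * varrho s b"
proof -
  \<comment> \<open>Padding with zeros to a sum over all divisors makes
    \<open>sum_divisors_mult_coprime\<close> applicable.\<close>
  have varrho_alt: "varrho s n = (\<Sum>d | d dvd n. if unitary_divisor d n then phi s d else 0)"
    if "n > 0" for n
    using that
    by (simp add: varrho_def flip: sum.inter_filter)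
      (intro sum.cong, auto simp: unitary_divisor_def)
  have "varrho s (a * b) = (\<Sum>d | d dvd a. \<Sum>c | c dvd b.
      if unitary_divisor (d * c) (a * b) then phi s (d * c) else 0)"
    using assms by (simp add: varrho_alt sum_divisors_mult_coprime)
  also have "\<dots> = (\<Sum>d | d dvd a. \<Sum>c | c dvd b.
      (if unitary_divisor d a then phi s d else 0) * (if unitary_divisor c b then phi s c else 0))"
  proof (intro sum.cong refl)
    fix d c assume "d \<in> {d. d dvd a}" "c \<in> {c. c dvd b}"
    then have dc: "d dvd a" "c dvd b" by auto
    then have "phi s (d * c) = phi s d * phi s c"
      using assms by (intro phi_mult_coprime coprime_divisors[OF _ _ assms(1)]) (auto intro: dvd_pos_nat)
    then show "(if unitary_divisor (d * c) (a * b) then phi s (d * c) else 0) =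
      (if unitary_divisor d a then phi s d else 0) * (if unitary_divisor c b then phi s c else 0)"
      using unitary_divisor_mult_coprime[OF assms(1) dc] by simp
  qed
  also have "\<dots> = varrho s a * varrho s b"
    using assms by (simp add: varrho_alt sum_product)
  finally show ?thesis .
qed

text \<open>The divisors \<open>p ^ i\<close> and \<open>p ^ (a - i)\<close> are coprime only if one
  exponent is 0, so the sum has just the terms at 1 and \<open>p ^ a\<close>.\<close>

lemma varrho_prime_power:
  assumes p: "prime p" and a: "a > 0"
  shows "varrho s (p ^ a) = 1 + real (p ^ a) powr s - real (p ^ (a - 1)) powr s"
proof -
  have "unitary_divisor d (p ^ a) \<longleftrightarrow> d = 1 \<or> d = p ^ a" for d
  proof
    assume d: "unitary_divisor d (p ^ a)"
    then obtain i where i: "i \<le> a" "d = p ^ i"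
      using p by (auto simp: unitary_divisor_def divides_primepow_nat)
    then have "coprime (p ^ i) (p ^ (a - i))"
      using d p by (simp add: unitary_divisor_def power_diff prime_gt_0_nat)
    then have "i = 0 \<or> a - i = 0"
      using p by (auto simp: coprime_power_left_iff coprime_power_right_iff)
    then show "d = 1 \<or> d = p ^ a" using i by auto
  qed (use p in \<open>auto simp: unitary_divisor_def prime_gt_0_nat Suc_leI\<close>)
  then have "{d. unitary_divisor d (p ^ a)} = {1, p ^ a}" by auto
  moreover have "p ^ a \<noteq> 1"
    using p a by (auto simp: prime_gt_1_nat)
  ultimately show ?thesis
    using phi_prime_power[OF p a, of s] phi_1[of s] by (simp add: varrho_def del: One_nat_def)
qed

text \<open>Pulling \<open>p ^ a\<close> to the power \<open>- r\<close> out of the value at each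
  prime power leaves the stated factor. A natural \<open>r\<close> turns the remaining real powers
  into ordinary ones.\<close>

lemma varrho_prod_formula:
  assumes "n > 0"
  shows "varrho (- real r) n = real n powr (- real r) *
    (\<Prod>p\<in>prime_factors n. real p ^ (r * multiplicity p n) - real p ^ r + 1)"
proof -
  let ?s = "- real r"
  have "varrho ?s 1 = 1"
  proof -
    have "{d. unitary_divisor d 1} = {1}" by (auto simp: unitary_divisor_def)
    then show ?thesis by (simp add: varrho_def phi_1[simplified])
  qed
  then have "varrho ?s n = (\<Prod>p\<in>prime_factors n. varrho ?s (p ^ multiplicity p n))"
    using varrho_mult_coprime assms by (intro multiplicative_prod_prime_powers) auto
  also have "\<dots> = (\<Prod>p\<in>prime_factors n. real (p ^ multiplicity p n) powr ?s *
      (real p ^ (r * multiplicity p n) - real p ^ r + 1))"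
  proof (intro prod.cong refl)
    fix p assume pn: "p \<in> prime_factors n"
    then have p: "prime p" by auto
    then have p0: "real p > 0" by (simp add: prime_gt_0_nat)
    have "multiplicity p n > 0"
      using pn by (simp add: prime_factors_multiplicity)
    then obtain b where b: "multiplicity p n = Suc b"
      by (cases "multiplicity p n") auto
    show "varrho ?s (p ^ multiplicity p n) = real (p ^ multiplicity p n) powr ?s *
        (real p ^ (r * multiplicity p n) - real p ^ r + 1)"
      using p0 unfolding b varrho_prime_power[OF p zero_less_Suc]
      by (simp add: powr_minus powr_realpow field_simps flip: power_mult power_add)
  qed
  also have "\<dots> = (\<Prod>p\<in>prime_factors n. real (p ^ multiplicity p n) powr ?s) *
      (\<Prod>p\<in>prime_factors n. real p ^ (r * multiplicity p n) - real p ^ r + 1)"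
    by (simp add: prod.distrib)
  \<comment> \<open>The extracted powers recombine because \<open>n powr ?s\<close> is itself
    multiplicative in \<open>n\<close>.\<close>
  also have "(\<Prod>p\<in>prime_factors n. real (p ^ multiplicity p n) powr ?s) = real n powr ?s"
    using multiplicative_prod_prime_powers[of "\<lambda>n. real n powr ?s" n] assms
    by (simp add: powr_mult)
  finally show ?thesis .
qed

section \<open>Moebius inversion over primitive fractions\<close>

lemma sum_divisors_flip:
  fixes n :: nat and f :: "nat \<Rightarrow> 'a::comm_monoid_add"
  assumes "n > 0"
  shows "(\<Sum>d | d dvd n. f (n div d)) = (\<Sum>d | d dvd n. f d)"
  by (rule sum.reindex_bij_witness[where i = "\<lambda>d. n div d" and j = "\<lambda>d. n div d"])
    (use assms in \<open>auto simp: div_dvd_iff_mult\<close>)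

text \<open>Read over complementary divisors, the sum is \<open>phi 0 n\<close>, hence
  multiplicative. Its value at a proper prime power is 1 - 1 = 0, so a single prime factor makes it
  vanish.\<close>

lemma sum_moebius_mu:
  assumes "n > 0"
  shows "(\<Sum>d | d dvd n. real_of_int (moebius_mu d)) = (if n = 1 then 1 else 0)"
proof -
  have "(\<Sum>d | d dvd n. real_of_int (moebius_mu d)) = phi 0 n"
    unfolding phi_def sum_divisors_flip[OF assms, symmetric, of "\<lambda>d. real_of_int (moebius_mu d)"]
    using assms by (intro sum.cong) auto
  also have "\<dots> = (\<Prod>p\<in>prime_factors n. phi 0 (p ^ multiplicity p n))"
    using phi_mult_coprime phi_1 assms by (intro multiplicative_prod_prime_powers) auto
  also have "\<dots> = (if n = 1 then 1 else 0)"
  proof (cases "n = 1")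
    case False
    then obtain p where "p \<in> prime_factors n"
      using assms prime_factor_nat[of n] by (auto simp: prime_factors_dvd)
    moreover have "phi 0 (p ^ multiplicity p n) = 0"
      using \<open>p \<in> prime_factors n\<close>
      by (subst phi_prime_power) (auto simp: prime_factors_multiplicity prime_gt_0_nat)
    ultimately show ?thesis
      using False by auto
  qed simp
  finally show ?thesis .
qed

text \<open>The condition \<open>coprime k n\<close> is detected by summing the Moebius function
  over the common divisors \<open>c\<close> of \<open>k\<close> and \<open>n\<close>. For fixed
  \<open>c\<close>, writing \<open>k = j * c\<close> turns \<open>k / n\<close> into a fraction with
  denominator \<open>n div c\<close>.\<close>

lemma sum_primitive_fractions:
  fixes f :: "real \<Rightarrow> real"
  assumes "n > 0"
  shows "(\<Sum>k | k \<in> {1..n} \<and> coprime k n. f (real k / real n))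
    = (\<Sum>d | d dvd n. of_int (moebius_mu (n div d)) * (\<Sum>j=1..d. f (real j / real d)))"
proof -
  have "(\<Sum>k | k \<in> {1..n} \<and> coprime k n. f (real k / real n))
      = (\<Sum>k=1..n. (\<Sum>c | c dvd gcd k n. of_int (moebius_mu c)) * f (real k / real n))"
    unfolding sum.inter_filter[OF finite_atLeastAtMost]
    using assms
    by (intro sum.cong refl, subst sum_moebius_mu) (simp_all add: coprime_iff_gcd_eq_1)
  also have "\<dots> = (\<Sum>k=1..n. \<Sum>c | c dvd n.
      if c dvd k then of_int (moebius_mu c) * f (real k / real n) else 0)"
  proof (intro sum.cong refl)
    fix k
    have "{c. c dvd gcd k n} = {c \<in> {c. c dvd n}. c dvd k}" by auto
    then show "(\<Sum>c | c dvd gcd k n. of_int (moebius_mu c)) * f (real k / real n)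
        = (\<Sum>c | c dvd n. if c dvd k then of_int (moebius_mu c) * f (real k / real n) else 0)"
      using assms by (simp add: sum_distrib_right flip: sum.inter_filter)
  qed
  also have "\<dots> = (\<Sum>c | c dvd n. \<Sum>k=1..n.
      if c dvd k then of_int (moebius_mu c) * f (real k / real n) else 0)"
    by (rule sum.swap)
  also have "\<dots> = (\<Sum>c | c dvd n.
      of_int (moebius_mu c) * (\<Sum>j=1..n div c. f (real j / real (n div c))))"
  proof (intro sum.cong refl)
    fix c assume "c \<in> {c. c dvd n}"
    then have c: "c dvd n" "c > 0" using assms by (auto intro: dvd_pos_nat)
    have "(\<Sum>k=1..n. if c dvd k then of_int (moebius_mu c) * f (real k / real n) else 0)
        = (\<Sum>k | k \<in> {1..n} \<and> c dvd k. of_int (moebius_mu c) * f (real k / real n))"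
      by (simp only: sum.inter_filter[OF finite_atLeastAtMost])
    also have "\<dots> = (\<Sum>j=1..n div c. of_int (moebius_mu c) * f (real j / real (n div c)))"
      by (rule sum.reindex_bij_witness[where i = "\<lambda>j. j * c" and j = "\<lambda>k. k div c"])
        (use c assms in \<open>auto simp: div_le_mono less_eq_div_iff_mult_less_eq real_of_nat_div elim!: dvdE\<close>)
    finally show "(\<Sum>k=1..n. if c dvd k then of_int (moebius_mu c) * f (real k / real n) else 0)
        = of_int (moebius_mu c) * (\<Sum>j=1..n div c. f (real j / real (n div c)))"
      by (simp add: sum_distrib_left)
  qed
  also have "\<dots> = (\<Sum>d | d dvd n.
      of_int (moebius_mu (n div d)) * (\<Sum>j=1..d. f (real j / real d)))"
    by (subst sum_divisors_flip[OF assms, symmetric], intro sum.cong refl) (use assms in auto)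
  finally show ?thesis .
qed

section \<open>The multiplication formula for Bernoulli polynomials\<close>

lemma fps_exp_minus_1_nonzero:
  assumes "c \<noteq> 0"
  shows "fps_exp (c::real) - 1 \<noteq> 0"
proof
  assume "fps_exp c - 1 = 0"
  then have "fps_nth (fps_exp c - 1) 1 = 0" by simp
  then show False using assms by simp
qed

text \<open>The generating functions at 1 and 0 differ by t (e^t - 1) / (e^t - 1) = t, so only the
  coefficient at index 1 changes.\<close>

lemma bernpoly_1:
  assumes "m \<ge> 2"
  shows "bernpoly m 1 = bernpoly m 0"
proof -
  have "(bernoulli_fps 1 - bernoulli_fps 0) * (fps_exp 1 - 1) = fps_X * (fps_exp 1 - 1)"
    by (simp only: left_diff_distrib[of "bernoulli_fps 1"] bernoulli_fps_mult fps_exp_0)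
      (simp add: algebra_simps)
  then have "bernoulli_fps 1 - bernoulli_fps 0 = fps_X"
    using fps_exp_minus_1_nonzero[of 1] by (simp only: mult_cancel_right) auto
  then have "fps_nth (bernoulli_fps 1 - bernoulli_fps 0) m = fps_nth (fps_X :: real fps) m"
    by simp
  then show ?thesis
    using assms by (simp add: bernpoly_def fps_X_def)
qed

text \<open>The geometric sum of e^(jt/d) over j < d is (e^t - 1) / (e^(t/d) - 1), so the left side
  is t / (e^(t/d) - 1), which is d times the generating function at 0 with t/d substituted for
  t.\<close>

lemma sum_bernoulli_fps:
  assumes "d > 0"
  shows "(\<Sum>j<d. bernoulli_fps (real j / real d))
    = fps_const (real d) * (bernoulli_fps 0 oo (fps_const (1 / real d) * fps_X))"
proof -
  let ?E = "fps_exp (1 / real d)" and ?c = "fps_const (1 / real d) * fps_X :: real fps"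
  have "(\<Sum>j<d. fps_exp (real j / real d)) = (\<Sum>j<d. ?E ^ j)"
    by (simp add: fps_exp_power_mult)
  then have geo: "(\<Sum>j<d. fps_exp (real j / real d)) * (?E - 1) = fps_exp 1 - 1"
    using assms power_diff_1_eq[of ?E d] by (simp add: fps_exp_power_mult mult.commute)
  have "(bernoulli_fps 0 oo ?c) * (?E - 1) = (bernoulli_fps 0 * (fps_exp 1 - 1)) oo ?c"
    by (simp add: fps_compose_mult_distrib fps_compose_sub_distrib fps_exp_compose_linear)
  also have "\<dots> = ?c"
    by (simp add: bernoulli_fps_mult)
  finally have comp: "(bernoulli_fps 0 oo ?c) * (?E - 1) = ?c" .
  \<comment> \<open>Both denominators are multiplied out here and cancelled as nonzero series at the
    end.\<close>
  have "(\<Sum>j<d. bernoulli_fps (real j / real d)) * ((fps_exp 1 - 1) * (?E - 1))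
      = fps_X * ((\<Sum>j<d. fps_exp (real j / real d)) * (?E - 1))"
    by (simp add: sum_distrib_right sum_distrib_left bernoulli_fps_mult flip: mult.assoc)
  also have "\<dots> = fps_const (real d) * ?c * (fps_exp 1 - 1)"
    using assms by (simp add: geo flip: mult.assoc)
  also have "\<dots> = fps_const (real d) * (bernoulli_fps 0 oo ?c) * ((fps_exp 1 - 1) * (?E - 1))"
    by (subst comp[symmetric]) (simp only: mult_ac)
  finally show ?thesis
    using fps_exp_minus_1_nonzero[of 1] fps_exp_minus_1_nonzero[of "1 / real d"] assms
    by (simp only: mult_cancel_right) auto
qed

text \<open>Comparing coefficients of t^m in \<open>sum_bernoulli_fps\<close>, the substitution of
  t/d contributes d^(-m) and the prefactor contributes d.\<close>

lemma sum_bernpoly: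
  assumes "d > 0" "m \<ge> 2"
  shows "(\<Sum>j=1..d. bernpoly m (real j / real d)) = real d powr (1 - real m) * bernoulli m"
proof -
  have "(\<Sum>j=1..d. bernpoly m (real j / real d)) = (\<Sum>j<d. bernpoly m (real (Suc j) / real d))"
    by (simp add: sum.atLeast1_atMost_eq)
  \<comment> \<open>The index shift trades the term at argument 1 for the one at 0; they agree by
    \<open>bernpoly_1\<close>.\<close>
  also have "\<dots> = (\<Sum>j<d. bernpoly m (real j / real d))"
    using sum.lessThan_Suc[of "\<lambda>j. bernpoly m (real j / real d)" d]
      sum.lessThan_Suc_shift[of "\<lambda>j. bernpoly m (real j / real d)" d] assms bernpoly_1[of m]
    by simp
  also have "\<dots> = fact m * fps_nth (\<Sum>j<d. bernoulli_fps (real j / real d)) m"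
    by (simp add: bernpoly_def fps_sum_nth sum_distrib_left)
  also have "\<dots> = real d / real d ^ m * bernoulli m"
    using assms
    by (simp add: sum_bernoulli_fps fps_compose_linear bernoulli_def bernpoly_def power_divide)
  also have "real d / real d ^ m = real d powr (1 - real m)"
    using assms by (simp add: powr_diff powr_realpow)
  finally show ?thesis .
qed

section \<open>Regular integers\<close>

text \<open>Put \<open>k = d * k'\<close> and \<open>n = d * n'\<close> with \<open>d\<close> the
  gcd. Cancelling \<open>d\<close> and then \<open>k'\<close>, which is coprime to
  \<open>n'\<close>, turns the congruence into invertibility of \<open>k\<close> mod
  \<open>n'\<close>, that is, coprimality of \<open>d\<close> and \<open>n'\<close>.\<close>

lemma regular_mod_iff:
  assumes "n > 0"
  shows "regular_mod n (int k) \<longleftrightarrow> unitary_divisor (gcd k n) n"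
proof -
  define d where "d = gcd k n"
  have d: "d > 0" using assms by (simp add: d_def)
  obtain k' n' where kn: "k = d * k'" "n = d * n'" and cop: "coprime k' n'"
    using gcd_coprime_exists[of k n] d unfolding d_def by (auto simp: mult.commute)
  have "[(int k)\<^sup>2 * x = int k] (mod int n) \<longleftrightarrow> [int (d * k') * x = 1] (mod int n')" for x
  proof -
    have "[(int k)\<^sup>2 * x = int k] (mod int n)
        \<longleftrightarrow> int d * int n' dvd int d * (int k' * (int (d * k') * x - 1))"
      by (simp add: kn cong_iff_dvd_diff power2_eq_square algebra_simps)
    also have "\<dots> \<longleftrightarrow> int n' dvd int k' * (int (d * k') * x - 1)"
      using d by simp
    also have "\<dots> \<longleftrightarrow> int n' dvd int (d * k') * x - 1"
      using cop by (intro coprime_dvd_mult_right_iff) (simp add: coprime_commute)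
    finally show ?thesis by (simp add: cong_iff_dvd_diff)
  qed
  then have "regular_mod n (int k) \<longleftrightarrow> coprime (int (d * k')) (int n')"
    by (simp add: regular_mod_def coprime_iff_invertible_int)
  also have "\<dots> \<longleftrightarrow> coprime d n'"
    using cop by (simp only: coprime_int_iff) simp
  also have "\<dots> \<longleftrightarrow> unitary_divisor d n"
    using d by (simp add: unitary_divisor_def kn)
  finally show ?thesis by (simp add: d_def)
qed

text \<open>Connects the gcd of \<open>k\<close> and \<open>n\<close>, which governs regularity,
  with the reduced denominator, which indexes \<open>sum_Reg\<close>.\<close>

lemma unitary_divisor_div:
  assumes "unitary_divisor d n" "n > 0"
  shows "unitary_divisor (n div d) n"
  using assms by (auto simp: unitary_divisor_def coprime_commute div_dvd_iff_mult dvd_div_eq_0_iff Suc_le_eq intro!: Nat.gr0I)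

text \<open>Each \<open>k / n\<close> has a unique reduced form \<open>j / d\<close> with
  \<open>d = n div gcd k n\<close>, and \<open>k\<close> is regular exactly when this
  \<open>d\<close> is a unitary divisor. The inverse map sends \<open>(d, j)\<close> to
  \<open>j * (n div d)\<close>.\<close>

lemma sum_Reg:
  fixes f :: "real \<Rightarrow> 'a::comm_monoid_add"
  assumes n: "n > 0"
  shows "(\<Sum>k\<in>Reg n. f (real k / real n))
    = (\<Sum>d | unitary_divisor d n. \<Sum>j | j \<in> {1..d} \<and> coprime j d. f (real j / real d))"
proof -
  have fin: "finite {d. unitary_divisor d n}"
    by (rule finite_subset[of _ "{d. d dvd n}"]) (use n in \<open>auto simp: unitary_divisor_def\<close>)
  have "(\<Sum>d | unitary_divisor d n. \<Sum>j | j \<in> {1..d} \<and> coprime j d. f (real j / real d))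
      = (\<Sum>(d, j) \<in> (SIGMA d:{d. unitary_divisor d n}. {j. j \<in> {1..d} \<and> coprime j d}).
          f (real j / real d))"
    using fin by (intro sum.Sigma) auto
  also have "\<dots> = (\<Sum>k\<in>Reg n. f (real k / real n))"
  proof (rule sum.reindex_bij_witness[where i = "\<lambda>k. (n div gcd k n, k div gcd k n)"
        and j = "\<lambda>(d, j). j * (n div d)"])
    fix p assume "p \<in> (SIGMA d:{d. unitary_divisor d n}. {j. j \<in> {1..d} \<and> coprime j d})"
    then obtain d j where p: "p = (d, j)" and d: "unitary_divisor d n"
      and j: "1 \<le> j" "j \<le> d" "coprime j d" by auto
    obtain e where e: "n = d * e" using d by (auto simp: unitary_divisor_def)
    have de: "d > 0" "e > 0" using n e by auto
    have g: "gcd (j * e) n = e"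
      using j(3) gcd_mult_distrib_nat[of e j d] by (simp add: e mult.commute)
    show "(n div gcd (case p of (d, j) \<Rightarrow> j * (n div d)) n,
        (case p of (d, j) \<Rightarrow> j * (n div d)) div gcd (case p of (d, j) \<Rightarrow> j * (n div d)) n) = p"
      using de g by (simp add: p) (simp add: e)
    have "unitary_divisor e n"
      using unitary_divisor_div[OF d n] de by (simp add: e)
    then show "(case p of (d, j) \<Rightarrow> j * (n div d)) \<in> Reg n"
      using j de g n by (simp add: p Reg_def regular_mod_iff) (simp add: e g[unfolded e] Suc_leI)
    show "f (real (case p of (d, j) \<Rightarrow> j * (n div d)) / real n) = (case p of (d, j) \<Rightarrow> f (real j / real d))"
      using de by (simp add: p e)
  next
    fix k assume "k \<in> Reg n"
    then have k: "1 \<le> k" "k \<le> n" and u: "unitary_divisor (gcd k n) n"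
      using n by (auto simp: Reg_def regular_mod_iff)
    have "n div (n div g) = g" if "g dvd n" for g
      using n that by auto
    then show "(case (n div gcd k n, k div gcd k n) of (d, j) \<Rightarrow> j * (n div d)) = k"
      by simp
    have "k div gcd k n \<ge> 1" using k by (simp add: Suc_le_eq dvd_div_eq_0_iff flip: neq0_conv)
    then show "(n div gcd k n, k div gcd k n) \<in>
        (SIGMA d:{d. unitary_divisor d n}. {j. j \<in> {1..d} \<and> coprime j d})"
      using k n unitary_divisor_div[OF u n] by (auto simp: div_le_mono intro: div_gcd_coprime)
  qed
  finally show ?thesis ..
qed

theorem proposition5p1p1:
  fixes n m :: nat
  assumes "n \<ge> 1" and "m \<ge> 2"
  shows "(\<Sum>k\<in>Reg n. bernpoly m (real k / real n)) = bernoulli m * varrho (1 - real m) n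
    \<and> varrho (1 - real m) n =
        real n powr (1 - real m) *
          (\<Prod>p\<in>prime_factors n. real p ^ ((m - 1) * multiplicity p n) - real p ^ (m - 1) + 1)"
proof
  \<comment> \<open>After Moebius inversion, \<open>sum_bernpoly\<close> evaluates each full sum of
    denominator \<open>c\<close>, and the divisor sum defining \<open>phi\<close> appears.\<close>
  have "(\<Sum>j | j \<in> {1..d} \<and> coprime j d. bernpoly m (real j / real d))
      = bernoulli m * phi (1 - real m) d" if "d > 0" for d
  proof -
    have "(\<Sum>j | j \<in> {1..d} \<and> coprime j d. bernpoly m (real j / real d))
        = (\<Sum>c | c dvd d. of_int (moebius_mu (d div c)) * (real c powr (1 - real m) * bernoulli m))"
      unfolding sum_primitive_fractions[OF that]
      using that assms by (intro sum.cong refl arg_cong2[of _ _ _ _ "(*)"] sum_bernpoly) (auto intro: dvd_pos_nat)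
    then show ?thesis
      by (simp add: phi_def sum_distrib_left mult_ac)
  qed
  then show "(\<Sum>k\<in>Reg n. bernpoly m (real k / real n)) = bernoulli m * varrho (1 - real m) n"
    using assms
    by (auto simp: sum_Reg varrho_def sum_distrib_left unitary_divisor_def intro!: sum.cong)
  \<comment> \<open>The truncated subtraction is exact since \<open>m\<close> is positive; this
    gives the form of the exponent in \<open>varrho_prod_formula\<close>.\<close>
  have "1 - real m = - real (m - 1)"
    using assms by simp
  then show "varrho (1 - real m) n = real n powr (1 - real m) *
      (\<Prod>p\<in>prime_factors n. real p ^ ((m - 1) * multiplicity p n) - real p ^ (m - 1) + 1)"
    using varrho_prod_formula[of n "m - 1"] assms by simp
qed

end
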